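(* Let $k,\ell,c$ be positive integers with $4\ell<k<2c\ell$, let $G=G_{k,\ell}$ with boundary $\Gamma=\{(i,1)\}_{i=1}^k$. For any $\varphi\in\mathbb{R}^k$, $$\frac{1}{\max\{\sqrt{3c},2\pi\}}\,|\varphi|_\Gamma\le\min_{u|_\Gamma=\varphi}|u|_G\le\sqrt{2c+\tfrac{233}{9}}\,|\varphi|_\Gamma,$$ where the minimum is over all functions $u$ on the vertices of $G$ whose restriction to $\Gamma$ equals $\varphi$.
   Context: $G_{k,\ell}=C_k\,\square\,P_\ell$ is the Cartesian product of the $k$-vertex cycle $C_k$ and the $\ell$-vertex path $P_\ell$; its vertices are $(i,j)$, $i=1,\dots,k$, $j=1,\dots,\ell$, with $(i,j)$ adjacent to $(i\pm1 \bmod k, j)$ and to $(i,j\pm1)$ when these exist; $\varphi(i)$ is the value at $(i,1)$. The energy semi-norm is $|u|_G^2=\sum_{\{p,q\}\in E(G)}(u(p)-u(q))^2$ and the boundary semi-norm is $|\varphi|_\Gamma^2=\sum_{p,q\in\Gamma,\,p<q}\frac{(\varphi(p)-\varphi(q))^2}{d_G(p,q)^2}$, where $d_G$ is the graph distance in $G$. *)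

theory Defs
  imports Complex_Main "HOL-Number_Theory.Cong"
begin

text \<open>A graph is a pair \<open>(V, E)\<close> of a vertex set and a set of edges \<open>{p, q}\<close>.\<close>

type_synonym 'a graph = "'a set \<times> 'a set set"

definition cycle_graph :: "nat \<Rightarrow> nat graph" where
  "cycle_graph k = ({1..k}, {{i, j} |i j. i \<in> {1..k} \<and> j \<in> {1..k} \<and> [j = i + 1] (mod k)})"

definition path_graph :: "nat \<Rightarrow> nat graph" where
  "path_graph l = ({1..l}, {{i, i + 1} |i. i \<in> {1..l} \<and> i + 1 \<in> {1..l}})"

definition cartesian_product :: "'a graph \<Rightarrow> 'b graph \<Rightarrow> ('a \<times> 'b) graph" where
  "cartesian_product G H =
     (fst G \<times> fst H,
      {{(a, b), (a', b)} |a a' b. {a, a'} \<in> snd G \<and> b \<in> fst H} \<union>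
      {{(a, b), (a, b')} |a b b'. a \<in> fst G \<and> {b, b'} \<in> snd H})"

definition grid :: "nat \<Rightarrow> nat \<Rightarrow> (nat \<times> nat) graph" where
  "grid k l = cartesian_product (cycle_graph k) (path_graph l)"

text \<open>The distance is the least length of a walk, i.e. the least power of the adjacency
  relation that relates the two vertices; it is meaningful for vertices joined by a walk.\<close>

definition graph_dist :: "'a graph \<Rightarrow> 'a \<Rightarrow> 'a \<Rightarrow> nat" where
  "graph_dist G p q = (LEAST n. (p, q) \<in> {(x, y). {x, y} \<in> snd G} ^^ n)"

text \<open>The squared difference of \<open>u\<close> along an unordered edge. It is written without choosing
  an orientation; see \<open>edge_sq_diff_pair\<close>.\<close>

definition edge_sq_diff :: "('a \<Rightarrow> real) \<Rightarrow> 'a set \<Rightarrow> real" where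
  "edge_sq_diff u e = (Max (u ` e) - Min (u ` e))\<^sup>2"

lemma edge_sq_diff_pair: "edge_sq_diff u {p, q} = (u p - u q)\<^sup>2"
  by (simp add: edge_sq_diff_def max_def min_def power2_commute)

text \<open>Only the values of \<open>u\<close> on the vertices of \<open>G\<close> matter here, so total functions stand for
  functions on the vertex set.\<close>

definition energy_seminorm :: "'a graph \<Rightarrow> ('a \<Rightarrow> real) \<Rightarrow> real" where
  "energy_seminorm G u = sqrt (\<Sum>e\<in>snd G. edge_sq_diff u e)"

text \<open>\<open>\<phi> \<in> \<real>\<^sup>k\<close> is given by its values \<open>\<phi> 1, \<dots>, \<phi> k\<close>, where \<open>\<phi> i\<close> is the value at the
  boundary vertex \<open>(i, 1)\<close>.\<close>

definition boundary_seminorm :: "nat \<Rightarrow> nat \<Rightarrow> (nat \<Rightarrow> real) \<Rightarrow> real" where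
  "boundary_seminorm k l \<phi> =
     sqrt (\<Sum>(i, j) \<in> {(i, j). i \<in> {1..k} \<and> j \<in> {1..k} \<and> i < j}.
       (\<phi> i - \<phi> j)\<^sup>2 / (real (graph_dist (grid k l) (i, 1) (j, 1)))\<^sup>2)"

definition extends_boundary :: "nat \<Rightarrow> (nat \<Rightarrow> real) \<Rightarrow> (nat \<times> nat \<Rightarrow> real) \<Rightarrow> bool" where
  "extends_boundary k \<phi> u \<longleftrightarrow> (\<forall>i\<in>{1..k}. u (i, 1) = \<phi> i)"

end

theory Submission
  imports Defs "HOL-Analysis.Function_Topology" "HOL-Analysis.Convex"
begin

text \<open>Write \<open>D h\<close> for the sum of the \<open>(\<phi> (i + h) - \<phi> i)\<^sup>2\<close> over the cycle. Grouping the pairs of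
  boundary vertices by their distance compares the squared boundary semi-norm with the sum of the
  \<open>D h / h\<^sup>2\<close>, over \<open>1 \<le> h \<le> k / 2\<close> from above and over \<open>1 \<le> h \<le> l\<close> from below.

  For the lower bound on the energy, replace the jump from \<open>i\<close> to \<open>i + h\<close> by a detour: climb to some row,
  move along it, and descend. For \<open>h \<le> 2l\<close> the row is about \<open>h / 2\<close>, so that each row is used by two
  shifts only and the vertical parts are controlled by Hardy's inequality; for \<open>h > 2l\<close> the
  estimate is averaged over all \<open>l\<close> rows. The horizontal parts then contribute at most
  \<open>3c\<close> times, and the vertical parts at most \<open>24\<close> times, the corresponding energy.

  For the upper bound, let the value at \<open>(i, j)\<close> be the mean of \<open>\<phi>\<close> over the window
  \<open>i, \<dots>, i + j - 1\<close>. The horizontal energy of row \<open>j\<close> is exactly \<open>D j / j\<^sup>2\<close>, and the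
  vertical energy is at most half of the sum of the \<open>D h / h\<^sup>2\<close>; so the constant \<open>3 / 2\<close> suffices.\<close>

section \<open>Edges and distances of the cylinder grid\<close>

text \<open>The index \<open>m\<close> is zero-based and unbounded. Functions on the cycle thus
  become \<open>k\<close>-periodic functions on the naturals, and a rotation is plain
  addition.\<close>

definition cycle_vertex :: "nat \<Rightarrow> nat \<Rightarrow> nat" where
  "cycle_vertex k m = Suc (m mod k)"

lemma cycle_vertex_in: "k > 0 \<Longrightarrow> cycle_vertex k m \<in> {1..k}"
  by (simp add: cycle_vertex_def Suc_leI)

lemma cycle_vertex_add_period [simp]: "cycle_vertex k (m + k) = cycle_vertex k m"
  by (simp add: cycle_vertex_def)

lemma cycle_vertex_mod [simp]: "cycle_vertex k (m mod k) = cycle_vertex k m"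
  by (simp add: cycle_vertex_def)

lemma cycle_vertex_eq_iff: "cycle_vertex k m = cycle_vertex k n \<longleftrightarrow> [m = n] (mod k)"
  by (simp add: cycle_vertex_def cong_def)

lemma cong_int_cycle_vertex: "[int (cycle_vertex k m) = int m + 1] (mod int k)"
  by (simp add: cycle_vertex_def cong_def zmod_int mod_add_right_eq add.commute)

lemma cong_int_cycle_vertex_add:
  "[int (cycle_vertex k (m + h)) = int (cycle_vertex k m) + int h] (mod int k)"
proof -
  have "[int (cycle_vertex k m) + int h = int m + 1 + int h] (mod int k)"
    by (intro cong_add cong_refl cong_int_cycle_vertex)
  moreover have "[int (cycle_vertex k (m + h)) = int m + 1 + int h] (mod int k)"
    using cong_int_cycle_vertex[of k "m + h"] by (simp add: add_ac)
  ultimately show ?thesis by (blast intro: cong_trans cong_sym)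
qed

lemma bij_betw_cycle_vertex: "bij_betw (cycle_vertex k) {..<k} {1..k}"
  by (rule bij_betwI[where g = "\<lambda>i. i - 1"]) (auto simp: cycle_vertex_def)

lemma cycle_graph_edges:
  assumes "k > 0"
  shows "snd (cycle_graph k) = (\<lambda>m. {cycle_vertex k m, cycle_vertex k (m + 1)}) ` {..<k}"
proof (intro equalityI subsetI)
  fix e assume "e \<in> snd (cycle_graph k)"
  then obtain i j where e: "e = {i, j}" and ij: "i \<in> {1..k}" "j \<in> {1..k}" "[j = i + 1] (mod k)"
    by (auto simp: cycle_graph_def)
  obtain m where m: "m < k" "i = cycle_vertex k m"
    using ij(1) by (intro that[of "i - 1"]) (auto simp: cycle_vertex_def)
  obtain n where n: "n < k" "j = cycle_vertex k n"
    using ij(2) by (intro that[of "j - 1"]) (auto simp: cycle_vertex_def)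
  have "[n + 1 = m + 1 + 1] (mod k)"
    using ij(3) m n by (simp add: cycle_vertex_def)
  then have "[n = m + 1] (mod k)"
    using cong_add_rcancel_nat by blast
  then have "j = cycle_vertex k (m + 1)"
    using n by (simp only: cycle_vertex_eq_iff)
  then show "e \<in> (\<lambda>m. {cycle_vertex k m, cycle_vertex k (m + 1)}) ` {..<k}"
    using e m by blast
next
  fix e assume "e \<in> (\<lambda>m. {cycle_vertex k m, cycle_vertex k (m + 1)}) ` {..<k}"
  then obtain m where m: "m < k" "e = {cycle_vertex k m, cycle_vertex k (m + 1)}" by blast
  have "[cycle_vertex k (m + 1) = cycle_vertex k m + 1] (mod k)"
    by (simp add: cycle_vertex_def cong_def mod_Suc_eq mod_Suc_Suc_eq)
  then show "e \<in> snd (cycle_graph k)"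
    using m cycle_vertex_in[OF assms] by (auto simp: cycle_graph_def)
qed

section \<open>Edges of the grid and the energy as an explicit sum\<close>

definition horizontal_edge :: "nat \<Rightarrow> nat \<times> nat \<Rightarrow> (nat \<times> nat) set" where
  "horizontal_edge k = (\<lambda>(j, m). {(cycle_vertex k m, Suc j), (cycle_vertex k (m + 1), Suc j)})"

definition vertical_edge :: "nat \<Rightarrow> nat \<times> nat \<Rightarrow> (nat \<times> nat) set" where
  "vertical_edge k = (\<lambda>(j, m). {(cycle_vertex k m, Suc j), (cycle_vertex k m, Suc (Suc j))})"

lemma grid_edges:
  assumes "k > 0"
  shows "snd (grid k l) =
    horizontal_edge k ` ({..<l} \<times> {..<k}) \<union> vertical_edge k ` ({..<l - 1} \<times> {..<k})"
proof -
  have horizontal: "{{(a, b), (a', b)} |a a' b. {a, a'} \<in> snd (cycle_graph k) \<and> b \<in> {1..l}}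
      = horizontal_edge k ` ({..<l} \<times> {..<k})" (is "?L = ?R")
  proof (intro equalityI subsetI)
    fix e assume "e \<in> ?L"
    then obtain a a' b where e: "e = {(a, b), (a', b)}" and a: "{a, a'} \<in> snd (cycle_graph k)"
      and b: "b \<in> {1..l}" by blast
    from a obtain m where m: "m < k" "{a, a'} = {cycle_vertex k m, cycle_vertex k (m + 1)}"
      by (auto simp: cycle_graph_edges[OF assms])
    \<comment> \<open>Taking an image of the unordered pair avoids a case split on its
      orientation.\<close>
    have "e = (\<lambda>x. (x, b)) ` {a, a'}" using e by simp
    also have "\<dots> = horizontal_edge k (b - 1, m)"
      using b by (simp add: m horizontal_edge_def)
    finally show "e \<in> ?R" using b m by auto
  next
    fix e assume "e \<in> ?R"
    then obtain j m where "j < l" "m < k" "e = horizontal_edge k (j, m)" by auto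
    then have "e = {(cycle_vertex k m, Suc j), (cycle_vertex k (m + 1), Suc j)}"
      "{cycle_vertex k m, cycle_vertex k (m + 1)} \<in> snd (cycle_graph k)" "Suc j \<in> {1..l}"
      by (simp_all add: horizontal_edge_def cycle_graph_edges[OF assms])
    then show "e \<in> ?L" unfolding mem_Collect_eq by (intro exI conjI)
  qed
  have vertical: "{{(a, b), (a, b')} |a b b'. a \<in> {1..k} \<and> {b, b'} \<in> snd (path_graph l)}
      = vertical_edge k ` ({..<l - 1} \<times> {..<k})" (is "?L = ?R")
  proof (intro equalityI subsetI)
    fix e assume "e \<in> ?L"
    then obtain a b b' where e: "e = {(a, b), (a, b')}" and a: "a \<in> {1..k}"
      and b: "{b, b'} \<in> snd (path_graph l)" by blast
    from b obtain i where i: "i \<in> {1..l}" "i + 1 \<in> {1..l}" "{b, b'} = {i, i + 1}"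
      by (auto simp: path_graph_def)
    have "e = (\<lambda>x. (a, x)) ` {b, b'}" using e by simp
    also have "\<dots> = vertical_edge k (i - 1, a - 1)"
      using i a by (auto simp add: i vertical_edge_def cycle_vertex_def)
    finally show "e \<in> ?R" using a i by auto
  next
    fix e assume "e \<in> ?R"
    then obtain j m where jm: "j < l - 1" "m < k" "e = vertical_edge k (j, m)" by auto
    then have "e = {(cycle_vertex k m, Suc j), (cycle_vertex k m, Suc (Suc j))}"
      "{Suc j, Suc (Suc j)} \<in> snd (path_graph l)"
      by (auto simp: vertical_edge_def path_graph_def)
    then show "e \<in> ?L"
      using cycle_vertex_in[OF assms, of m] unfolding mem_Collect_eq by (intro exI conjI)
  qed
  have vertices: "fst (cycle_graph k) = {1..k}" "fst (path_graph l) = {1..l}"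
    by (simp_all add: cycle_graph_def path_graph_def)
  show ?thesis
    unfolding grid_def cartesian_product_def snd_conv vertices horizontal vertical ..
qed

text \<open>Two indices could share an edge only by traversing it in opposite directions, which
  forces \<open>2 = 0\<close> modulo \<open>k\<close>. This is where \<open>k \<ge> 3\<close>
  enters: for \<open>k = 2\<close> the two horizontal edges of a row coincide.\<close>

lemma inj_on_horizontal_edge:
  assumes "k \<ge> 3"
  shows "inj_on (horizontal_edge k) ({..<l} \<times> {..<k})"
proof (rule inj_onI, clarsimp)
  fix i m j n
  assume m: "m < k" and n: "n < k" and eq: "horizontal_edge k (i, m) = horizontal_edge k (j, n)"
  have ij: "i = j" using eq by (auto simp: horizontal_edge_def doubleton_eq_iff)
  have "m = n"
  proof (rule ccontr)
    assume "m \<noteq> n"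
    then have "cycle_vertex k m \<noteq> cycle_vertex k n"
      using m n by (simp add: cycle_vertex_def)
    then have "cycle_vertex k m = cycle_vertex k (n + 1)" "cycle_vertex k (m + 1) = cycle_vertex k n"
      using eq by (auto simp: horizontal_edge_def doubleton_eq_iff)
    then have 1: "[m = n + 1] (mod k)" and 2: "[m + 1 = n] (mod k)"
      by (simp_all only: cycle_vertex_eq_iff)
    have "[m + 2 = n + 1] (mod k)" using cong_add[OF 2 cong_refl[of 1]] by simp
    then have "[m + 2 = m + 0] (mod k)" using 1 by (metis add.right_neutral cong_sym cong_trans)
    then have "[2 = 0] (mod k)" using cong_add_lcancel_nat by blast
    then show False using assms by (auto simp: cong_def)
  qed
  with ij show "i = j \<and> m = n" by blast
qed

lemma inj_on_vertical_edge: "inj_on (vertical_edge k) (A \<times> {..<k})"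
proof (rule inj_onI, clarsimp)
  fix i m j n
  assume m: "m < k" and n: "n < k" and "vertical_edge k (i, m) = vertical_edge k (j, n)"
  then have "cycle_vertex k m = cycle_vertex k n" "i = j"
    by (auto simp: vertical_edge_def doubleton_eq_iff)
  then show "i = j \<and> m = n" using m n by (simp add: cycle_vertex_def)
qed

lemma horizontal_vertical_disjoint:
  "horizontal_edge k ` A \<inter> vertical_edge k ` B = {}"
proof -
  have "horizontal_edge k p \<noteq> vertical_edge k q" for p q
    by (cases p; cases q) (auto simp: horizontal_edge_def vertical_edge_def doubleton_eq_iff)
  then show ?thesis by blast
qed

definition grid_energy :: "nat \<Rightarrow> nat \<Rightarrow> (nat \<times> nat \<Rightarrow> real) \<Rightarrow> real" where
  "grid_energy k l u =
     (\<Sum>j<l. \<Sum>m<k. (u (cycle_vertex k (m + 1), Suc j) - u (cycle_vertex k m, Suc j))\<^sup>2) +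
     (\<Sum>j<l - 1. \<Sum>m<k. (u (cycle_vertex k m, Suc (Suc j)) - u (cycle_vertex k m, Suc j))\<^sup>2)"

lemma energy_seminorm_grid:
  assumes "k \<ge> 3"
  shows "energy_seminorm (grid k l) u = sqrt (grid_energy k l u)"
proof -
  let ?A = "{..<l} \<times> {..<k}" and ?B = "{..<l - 1} \<times> {..<k}"
  have "(\<Sum>e\<in>snd (grid k l). edge_sq_diff u e)
      = (\<Sum>e\<in>horizontal_edge k ` ?A. edge_sq_diff u e) + (\<Sum>e\<in>vertical_edge k ` ?B. edge_sq_diff u e)"
    using assms by (simp add: grid_edges sum.union_disjoint horizontal_vertical_disjoint)
  also have "\<dots> = (\<Sum>p\<in>?A. edge_sq_diff u (horizontal_edge k p)) + (\<Sum>p\<in>?B. edge_sq_diff u (vertical_edge k p))"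
    using inj_on_horizontal_edge[OF assms] inj_on_vertical_edge by (simp add: sum.reindex)
  also have "\<dots> = grid_energy k l u"
    by (simp add: grid_energy_def sum.cartesian_product horizontal_edge_def vertical_edge_def
        case_prod_unfold edge_sq_diff_pair power2_commute)
  finally show ?thesis by (simp add: energy_seminorm_def)
qed

section \<open>Walks and distances between boundary vertices\<close>

lemma adjacent_horizontal:
  assumes "k > 0" "l > 0"
  shows "{(cycle_vertex k m, 1), (cycle_vertex k (m + 1), 1)} \<in> snd (grid k l)"
proof -
  have "cycle_vertex k (m mod k + 1) = cycle_vertex k (m + 1)"
    by (simp add: cycle_vertex_def mod_simps)
  then have "{(cycle_vertex k m, 1), (cycle_vertex k (m + 1), 1)} = horizontal_edge k (0, m mod k)"
    by (simp add: horizontal_edge_def)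
  then show ?thesis using assms by (simp add: grid_edges)
qed

lemma relpow_symD:
  assumes "sym R" "(x, y) \<in> R ^^ n"
  shows "(y, x) \<in> R ^^ n"
  using assms(2)
proof (induction n arbitrary: y)
  case (Suc n)
  then show ?case using symD[OF assms(1)] by (blast intro: relpow_Suc_I2 elim: relpow_Suc_E)
qed simp

lemma walk_along_cycle:
  assumes "k > 0" "l > 0"
  shows "((cycle_vertex k m, 1), (cycle_vertex k (m + n), 1)) \<in> {(x, y). {x, y} \<in> snd (grid k l)} ^^ n"
proof (induction n)
  case (Suc n)
  then show ?case
    using adjacent_horizontal[OF assms, of "m + n"] by (auto intro: relpow_Suc_I)
qed simp

text \<open>Each step changes the first coordinate by -1, 0 or 1 modulo \<open>k\<close>;
  \<open>t\<close> is the sum of these changes, lifted to the integers. This bounds distances from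
  below.\<close>

lemma walk_displacement:
  assumes "k > 0" "(p, q) \<in> {(x, y). {x, y} \<in> snd (grid k l)} ^^ n"
  shows "\<exists>t. \<bar>t\<bar> \<le> int n \<and> [int (fst q) = int (fst p) + t] (mod int k)"
  using assms(2)
proof (induction n arbitrary: q)
  case 0
  then show ?case by (intro exI[of _ 0]) auto
next
  case (Suc n)
  then obtain r where r: "(p, r) \<in> {(x, y). {x, y} \<in> snd (grid k l)} ^^ n"
    and e: "{r, q} \<in> snd (grid k l)" by auto
  obtain t where t: "\<bar>t\<bar> \<le> int n" "[int (fst r) = int (fst p) + t] (mod int k)"
    using Suc.IH[OF r] by blast
  have step: "[int (cycle_vertex k (m + 1)) = int (cycle_vertex k m) + 1] (mod int k)" for m
    using cong_int_cycle_vertex_add[of k m 1] by simp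
  have "\<exists>s. \<bar>s\<bar> \<le> 1 \<and> [int (fst q) = int (fst r) + s] (mod int k)"
  proof -
    consider (h) j m where "{r, q} = horizontal_edge k (j, m)"
      | (v) j m where "{r, q} = vertical_edge k (j, m)"
      using e assms(1) by (auto simp: grid_edges)
    then show ?thesis
    proof cases
      case h
      then consider "fst r = cycle_vertex k m" "fst q = cycle_vertex k (m + 1)"
        | "fst q = cycle_vertex k m" "fst r = cycle_vertex k (m + 1)"
        by (auto simp: horizontal_edge_def doubleton_eq_iff)
      then show ?thesis
      proof cases
        case 1
        then show ?thesis using step[of m] by (intro exI[of _ 1]) simp
      next
        case 2
        have "[int (fst r) - 1 = int (fst q) + 1 - 1] (mod int k)"
          using step[of m] unfolding 2 by (intro cong_diff cong_refl)
        then show ?thesis by (intro exI[of _ "-1"]) (simp add: cong_sym)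
      qed
    next
      case v
      then have "fst q = fst r" by (auto simp: vertical_edge_def doubleton_eq_iff)
      then show ?thesis by (intro exI[of _ 0]) simp
    qed
  qed
  then obtain s where s: "\<bar>s\<bar> \<le> 1" "[int (fst q) = int (fst r) + s] (mod int k)" by blast
  have "[int (fst r) + s = int (fst p) + t + s] (mod int k)"
    using t(2) by (intro cong_add cong_refl)
  then have "[int (fst q) = int (fst p) + (t + s)] (mod int k)"
    using s(2) by (metis add.assoc cong_trans)
  then show ?case using s(1) t(1) by (intro exI[of _ "t + s"]) auto
qed

text \<open>The two arcs of the boundary cycle give walks of lengths \<open>h\<close> and
  \<open>k - h\<close>. Leaving the boundary row gives no shortcut, because the displacement of any
  walk is congruent to \<open>h\<close> modulo \<open>k\<close>.\<close>

lemma graph_dist_boundary: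
  assumes "l > 0" "0 < h" "h < k"
  shows "graph_dist (grid k l) (cycle_vertex k m, 1) (cycle_vertex k (m + h), 1) = min h (k - h)"
proof -
  let ?R = "{(x, y). {x, y} \<in> snd (grid k l)}"
  let ?p = "(cycle_vertex k m, 1)" and ?q = "(cycle_vertex k (m + h), 1)"
  have k: "k > 0" using assms by simp
  have "(?p, ?q) \<in> ?R ^^ h" by (rule walk_along_cycle[OF k assms(1)])
  moreover have "(?p, ?q) \<in> ?R ^^ (k - h)"
  proof -
    have "(?q, ?p) \<in> ?R ^^ (k - h)"
      using walk_along_cycle[OF k assms(1), of "m + h" "k - h"] assms by simp
    moreover have "sym ?R"
      by (auto simp: sym_def insert_commute)
    ultimately show ?thesis by (blast intro: relpow_symD)
  qed
  ultimately have ex: "(?p, ?q) \<in> ?R ^^ min h (k - h)" by (simp add: min_def)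
  moreover have "min h (k - h) \<le> n" if n: "(?p, ?q) \<in> ?R ^^ n" for n
  proof -
    obtain t where t: "\<bar>t\<bar> \<le> int n"
      "[int (cycle_vertex k (m + h)) = int (cycle_vertex k m) + t] (mod int k)"
      using walk_displacement[OF k n] by auto
    have "[int (cycle_vertex k m) + int h = int (cycle_vertex k m) + t] (mod int k)"
      using cong_int_cycle_vertex_add t(2) by (blast intro: cong_trans cong_sym)
    then have "[int h = t] (mod int k)" using cong_add_lcancel by blast
    then obtain z where z: "int h = t + int k * z" 
      by (metis cong_iff_lin cong_sym)
    \<comment> \<open>For \<open>z \<le> 0\<close> the displacement \<open>t\<close> is at least
      \<open>h\<close>; otherwise it is at most \<open>h - k\<close>.\<close>
    show ?thesis
    proof (cases "z \<le> 0")
      case True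
      then have "int k * z \<le> 0" by (simp add: mult_le_0_iff)
      then show ?thesis using z t(1) by linarith
    next
      case False
      then have "int k * 1 \<le> int k * z" by (intro mult_left_mono) auto
      then show ?thesis using z t(1) assms by linarith
    qed
  qed
  ultimately show ?thesis unfolding graph_dist_def by (intro Least_equality)
qed

section \<open>The boundary semi-norm as a sum over shifts\<close>

lemma graph_dist_commute:
  "graph_dist G p q = graph_dist G q p"
proof -
  have "sym {(x, y). {x, y} \<in> snd G}" by (auto simp: sym_def insert_commute)
  then have "(p, q) \<in> {(x, y). {x, y} \<in> snd G} ^^ n \<longleftrightarrow> (q, p) \<in> {(x, y). {x, y} \<in> snd G} ^^ n" for n
    using relpow_symD by metis
  then show ?thesis by (simp add: graph_dist_def)
qed

text \<open>Moving the window of summation by one place replaces \<open>g t\<close> by the equal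
  value \<open>g (t + k)\<close>.\<close>

lemma sum_periodic_shift:
  fixes g :: "nat \<Rightarrow> 'a::ab_group_add"
  assumes "\<And>m. g (m + k) = g m"
  shows "(\<Sum>m<k. g (m + t)) = (\<Sum>m<k. g m)"
proof (induction t)
  case (Suc t)
  have "(\<Sum>m<k. g (m + Suc t)) + g t = (\<Sum>m<Suc k. g (m + t))"
    by (simp add: sum.lessThan_Suc_shift add.commute del: sum.lessThan_Suc)
  also have "\<dots> = (\<Sum>m<k. g (m + t)) + g t"
    using assms[of t] by (simp add: add.commute)
  finally show ?case using Suc by simp
qed simp

definition shift_energy :: "nat \<Rightarrow> (nat \<Rightarrow> real) \<Rightarrow> nat \<Rightarrow> real" where
  "shift_energy k f h = (\<Sum>m<k. (f (m + h) - f m)\<^sup>2)"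

lemma shift_energy_nonneg [simp]: "shift_energy k f h \<ge> 0"
  by (simp add: shift_energy_def sum_nonneg)

text \<open>A jump by \<open>h\<close> followed by one by \<open>k - h\<close> closes up, so both
  shifts compare the same pairs of points.\<close>

lemma shift_energy_reflect:
  assumes periodic: "\<And>m. f (m + k) = f m" and "h \<le> k"
  shows "shift_energy k f (k - h) = shift_energy k f h"
proof -
  have "shift_energy k f (k - h) = (\<Sum>m<k. (f (m + h + (k - h)) - f (m + h))\<^sup>2)"
    unfolding shift_energy_def
  proof (rule sum_periodic_shift[symmetric])
    show "(f (m + k + (k - h)) - f (m + k))\<^sup>2 = (f (m + (k - h)) - f m)\<^sup>2" for m
      using periodic[of m] periodic[of "m + (k - h)"] by (simp add: add_ac)
  qed
  also have "\<dots> = shift_energy k f h"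
    using assms by (simp add: shift_energy_def add.assoc power2_commute)
  finally show ?thesis .
qed

lemma bij_betw_cycle_vertex_shift:
  assumes "k > 0"
  shows "bij_betw (\<lambda>h. cycle_vertex k (m + h)) {..<k} {1..k}"
proof -
  have inj: "inj_on (\<lambda>h. cycle_vertex k (m + h)) {..<k}"
    by (rule inj_onI) (simp add: cycle_vertex_eq_iff cong_add_lcancel_nat cong_less_modulus_unique_nat)
  moreover have "(\<lambda>h. cycle_vertex k (m + h)) ` {..<k} = {1..k}"
    using cycle_vertex_in[OF assms] inj
    by (intro card_subset_eq) (auto simp: card_image simp del: atLeastAtMost_iff)
  ultimately show ?thesis by (simp add: bij_betw_def)
qed

text \<open>Summing over ordered pairs counts every unordered pair twice, which turns the sum over
  \<open>i < j\<close> into a sum over shifts of the cycle.\<close>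

lemma boundary_seminorm_shift:
  fixes \<phi> :: "nat \<Rightarrow> real"
  assumes "k > 0" "l > 0"
  shows "2 * (boundary_seminorm k l \<phi>)\<^sup>2 =
    (\<Sum>h<k. shift_energy k (\<lambda>m. \<phi> (cycle_vertex k m)) h / (real (min h (k - h)))\<^sup>2)"
proof -
  define w where "w i j = (\<phi> i - \<phi> j)\<^sup>2 / (real (graph_dist (grid k l) (i, 1) (j, 1)))\<^sup>2" for i j
  have sym: "w i j = w j i" for i j
    unfolding w_def by (subst graph_dist_commute) (simp add: power2_commute)
  have diag: "w i i = 0" for i by (simp add: w_def)
  have w0: "w i j \<ge> 0" for i j by (simp add: w_def)
  let ?P = "{(i, j). i \<in> {1..k} \<and> j \<in> {1..k} \<and> i < j}"
  let ?Q = "{(i, j). i \<in> {1..k} \<and> j \<in> {1..k} \<and> j < i}"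
  let ?R = "{(i, j). i \<in> {1..k} \<and> j \<in> {1..k} \<and> i = j}"
  have fin: "finite ?P" "finite ?Q" "finite ?R"
    by (rule finite_subset[of _ "{1..k} \<times> {1..k}"]; force)+
  have QP: "(\<Sum>(i, j)\<in>?Q. w i j) = (\<Sum>(i, j)\<in>?P. w i j)"
    by (rule sum.reindex_bij_witness[where i = prod.swap and j = prod.swap]) (auto simp: sym)
  have "(boundary_seminorm k l \<phi>)\<^sup>2 = (\<Sum>(i, j)\<in>?P. w i j)"
    unfolding boundary_seminorm_def w_def[symmetric]
    by (rule real_sqrt_pow2) (auto intro!: sum_nonneg simp: w0)
  then have "2 * (boundary_seminorm k l \<phi>)\<^sup>2 = (\<Sum>(i, j)\<in>?P. w i j) + (\<Sum>(i, j)\<in>?Q. w i j) + (\<Sum>(i, j)\<in>?R. w i j)"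
    using QP by (simp add: case_prod_unfold diag)
  also have "\<dots> = (\<Sum>(i, j)\<in>?P \<union> ?Q. w i j) + (\<Sum>(i, j)\<in>?R. w i j)"
    using fin by (subst sum.union_disjoint) auto
  also have "\<dots> = (\<Sum>(i, j)\<in>?P \<union> ?Q \<union> ?R. w i j)"
    using fin by (subst sum.union_disjoint) auto
  also have "?P \<union> ?Q \<union> ?R = {1..k} \<times> {1..k}" by auto
  also have "(\<Sum>(i, j)\<in>{1..k} \<times> {1..k}. w i j) = (\<Sum>i\<in>{1..k}. \<Sum>j\<in>{1..k}. w i j)"
    by (simp add: sum.cartesian_product)
  also have "\<dots> = (\<Sum>m<k. \<Sum>j\<in>{1..k}. w (cycle_vertex k m) j)"
    by (rule sum.reindex_bij_betw[OF bij_betw_cycle_vertex, symmetric])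
  also have "\<dots> = (\<Sum>m<k. \<Sum>h<k. w (cycle_vertex k m) (cycle_vertex k (m + h)))"
    by (intro sum.cong refl sum.reindex_bij_betw[OF bij_betw_cycle_vertex_shift, symmetric] assms)
  also have "\<dots> = (\<Sum>h<k. \<Sum>m<k. w (cycle_vertex k m) (cycle_vertex k (m + h)))"
    by (rule sum.swap)
  also have "\<dots> = (\<Sum>h<k. shift_energy k (\<lambda>m. \<phi> (cycle_vertex k m)) h / (real (min h (k - h)))\<^sup>2)"
  proof (rule sum.cong[OF refl])
    fix h assume h: "h \<in> {..<k}"
    have "w (cycle_vertex k m) (cycle_vertex k (m + h)) =
        (\<phi> (cycle_vertex k (m + h)) - \<phi> (cycle_vertex k m))\<^sup>2 / (real (min h (k - h)))\<^sup>2" for m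
    \<comment> \<open>The distance formula needs \<open>h > 0\<close>; for \<open>h = 0\<close> both
      sides vanish, as their numerators do.\<close>
    proof (cases "h = 0")
      case False
      then show ?thesis
        unfolding w_def using h graph_dist_boundary[OF assms(2), of h k m]
        by (simp add: power2_commute)
    qed (simp add: diag)
    then show "(\<Sum>m<k. w (cycle_vertex k m) (cycle_vertex k (m + h))) =
        shift_energy k (\<lambda>m. \<phi> (cycle_vertex k m)) h / (real (min h (k - h)))\<^sup>2"
      by (simp add: shift_energy_def sum_divide_distrib)
  qed
  finally show ?thesis .
qed

text \<open>The shifts \<open>h\<close> and \<open>k - h\<close> contribute equally, which cancels
  the factor 2 of the ordered pairs. For even \<open>k\<close> the shift \<open>k / 2\<close> is its
  own reflection: counting it twice costs equality in the upper bound, and \<open>2 * n < k\<close>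
  excludes it from the lower one.\<close>

lemma boundary_seminorm_bounds:
  fixes \<phi> :: "nat \<Rightarrow> real"
  assumes "k > 0" "l > 0"
  defines "D \<equiv> shift_energy k (\<lambda>m. \<phi> (cycle_vertex k m))"
  shows boundary_seminorm_le: "(boundary_seminorm k l \<phi>)\<^sup>2 \<le> (\<Sum>h=1..k div 2. D h / (real h)\<^sup>2)"
    and boundary_seminorm_ge: "2 * n < k \<Longrightarrow> (\<Sum>h=1..n. D h / (real h)\<^sup>2) \<le> (boundary_seminorm k l \<phi>)\<^sup>2"
proof -
  define g where "g h = D h / (real (min h (k - h)))\<^sup>2" for h
  have g0: "g h \<ge> 0" for h by (simp add: g_def D_def)
  have B: "2 * (boundary_seminorm k l \<phi>)\<^sup>2 = (\<Sum>h<k. g h)"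
    unfolding g_def D_def by (rule boundary_seminorm_shift[OF assms(1,2)])
  have reflect: "g (k - h) = g h" if "h \<le> k" for h
    using that unfolding g_def D_def by (subst shift_energy_reflect) (auto simp: min.commute)
  have half: "(\<Sum>h=1..n. g h) = (\<Sum>h=1..n. D h / (real h)\<^sup>2)"
    "(\<Sum>h\<in>(\<lambda>h. k - h) ` {1..n}. g h) = (\<Sum>h=1..n. D h / (real h)\<^sup>2)" if n: "2 * n \<le> k" for n
  proof -
    show *: "(\<Sum>h=1..n. g h) = (\<Sum>h=1..n. D h / (real h)\<^sup>2)"
      using n by (intro sum.cong) (auto simp: g_def min_def)
    have "inj_on (\<lambda>h. k - h) {1..n}" using n by (auto simp: inj_on_def)
    then have "(\<Sum>h\<in>(\<lambda>h. k - h) ` {1..n}. g h) = (\<Sum>h=1..n. g (k - h))"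
      by (simp add: sum.reindex)
    also have "\<dots> = (\<Sum>h=1..n. g h)" using n by (intro sum.cong refl reflect) auto
    finally show "(\<Sum>h\<in>(\<lambda>h. k - h) ` {1..n}. g h) = (\<Sum>h=1..n. D h / (real h)\<^sup>2)"
      using * by simp
  qed
  show "(boundary_seminorm k l \<phi>)\<^sup>2 \<le> (\<Sum>h=1..k div 2. D h / (real h)\<^sup>2)"
  proof -
    let ?A = "{1..k div 2}"
    have "h \<in> insert 0 (?A \<union> (\<lambda>h. k - h) ` ?A)" if "h < k" for h
    proof (cases "h \<le> k div 2")
      case False
      then have "h = k - (k - h)" "k - h \<in> ?A" using that by auto
      then show ?thesis by blast
    qed auto
    then have sub: "{..<k} \<subseteq> insert 0 (?A \<union> (\<lambda>h. k - h) ` ?A)" by blast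
    have "(\<Sum>h<k. g h) \<le> (\<Sum>h\<in>insert 0 (?A \<union> (\<lambda>h. k - h) ` ?A). g h)"
      by (intro sum_mono2 sub g0) auto
    also have "\<dots> = (\<Sum>h\<in>?A \<union> (\<lambda>h. k - h) ` ?A. g h)"
      by (intro sum.mono_neutral_right) (auto simp: g_def)
    also have "\<dots> \<le> (\<Sum>h\<in>?A. g h) + (\<Sum>h\<in>(\<lambda>h. k - h) ` ?A. g h)"
      by (subst sum_Un) (auto intro: sum_nonneg g0)
    also have "\<dots> = 2 * (\<Sum>h=1..k div 2. D h / (real h)\<^sup>2)"
      using half[of "k div 2"] by linarith
    finally show ?thesis using B by simp
  qed
  show "(\<Sum>h=1..n. D h / (real h)\<^sup>2) \<le> (boundary_seminorm k l \<phi>)\<^sup>2" if n: "2 * n < k"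
  proof -
    have "2 * (\<Sum>h=1..n. D h / (real h)\<^sup>2) = (\<Sum>h=1..n. g h) + (\<Sum>h\<in>(\<lambda>h. k - h) ` {1..n}. g h)"
      using half[of n] n by linarith
    also have "\<dots> = (\<Sum>h\<in>{1..n} \<union> (\<lambda>h. k - h) ` {1..n}. g h)"
      using n by (intro sum.union_disjoint[symmetric]) auto
    also have "\<dots> \<le> (\<Sum>h<k. g h)"
      using n by (intro sum_mono2) (auto intro: g0)
    finally show ?thesis using B by simp
  qed
qed

section \<open>The trace inequality\<close>

text \<open>The second summand on the left makes Hardy's inequality provable by induction.\<close>

lemma hardy_inequality_aux:
  fixes a :: "nat \<Rightarrow> real"
  shows "(\<Sum>n=1..N. ((\<Sum>i<n. a i) / n)\<^sup>2) + 2 * N * ((\<Sum>i<N. a i) / N)\<^sup>2 \<le> 4 * (\<Sum>i<N. (a i)\<^sup>2)"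
proof (induction N)
  case (Suc N)
  define A where "A = (\<Sum>i<N. a i) / N"
  define B where "B = (\<Sum>i<Suc N. a i) / Suc N"
  \<comment> \<open>For \<open>N = 0\<close> division by zero gives \<open>A = 0\<close>, which is
    consistent with the empty sum.\<close>
  have "N * A = (\<Sum>i<N. a i)" by (cases "N = 0") (simp_all add: A_def)
  then have "(N + 1) * B = N * A + a N" by (simp add: B_def)
  then have a: "a N = (N + 1) * B - N * A" by simp
  \<comment> \<open>With \<open>a N\<close> written through the consecutive means \<open>A\<close>
    and \<open>B\<close>, these squares are exactly the slack in the induction step.\<close>
  have "0 \<le> (B - 2 * a N)\<^sup>2 + 2 * N * (A - B)\<^sup>2" by simp
  also have "\<dots> = 4 * (a N)\<^sup>2 - (2 * N + 3) * B\<^sup>2 + 2 * N * A\<^sup>2"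
    unfolding a by (simp add: algebra_simps power2_eq_square)
  finally have "B\<^sup>2 + 2 * real (Suc N) * B\<^sup>2 \<le> 2 * N * A\<^sup>2 + 4 * (a N)\<^sup>2"
    by (simp add: algebra_simps)
  moreover have "(\<Sum>n=1..Suc N. ((\<Sum>i<n. a i) / n)\<^sup>2) = (\<Sum>n=1..N. ((\<Sum>i<n. a i) / n)\<^sup>2) + B\<^sup>2"
    by (simp add: B_def)
  moreover have "(\<Sum>i<Suc N. (a i)\<^sup>2) = (\<Sum>i<N. (a i)\<^sup>2) + (a N)\<^sup>2" by simp
  ultimately show ?case using Suc.IH
    unfolding A_def[symmetric] B_def[symmetric] by linarith
qed simp

lemma hardy_inequality:
  fixes a :: "nat \<Rightarrow> real"
  shows "(\<Sum>n=1..N. ((\<Sum>i<n. a i) / n)\<^sup>2) \<le> 4 * (\<Sum>i<N. (a i)\<^sup>2)"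
proof -
  have "0 \<le> 2 * N * ((\<Sum>i<N. a i) / N)\<^sup>2" by simp
  then show ?thesis using hardy_inequality_aux[of a N] by linarith
qed

text \<open>The terms are dominated by the telescoping differences
  \<open>1 / m - 1 / (m + 1)\<close>.\<close>

lemma sum_inverse_squares_le:
  assumes "n > 0" "n \<le> N"
  shows "(\<Sum>h=n+1..N. 1 / (real h)\<^sup>2) \<le> 1 / n - 1 / N"
  using assms(2)
proof (induction rule: dec_induct)
  case (step m)
  have "1 / (real (Suc m))\<^sup>2 \<le> 1 / (real m * Suc m)"
    unfolding power2_eq_square using assms step by (intro divide_left_mono mult_right_mono) auto
  also have "\<dots> = 1 / m - 1 / Suc m"
    using assms step by (simp add: field_simps)
  finally have "1 / (real (Suc m))\<^sup>2 \<le> 1 / m - 1 / Suc m" .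
  then show ?case using step by (simp add: sum.nat_ivl_Suc')
qed simp

lemma power2_sum3_le: "(x + y + z)\<^sup>2 \<le> 3 * (x\<^sup>2 + y\<^sup>2 + z\<^sup>2)" for x y z :: real
proof -
  have "0 \<le> (x - y)\<^sup>2 + (y - z)\<^sup>2 + (z - x)\<^sup>2" by simp
  then show ?thesis by (simp add: power2_eq_square algebra_simps)
qed

text \<open>\<open>U m j\<close> is the value in column \<open>m\<close> and row \<open>j\<close>,
  both zero-based, with the cycle unrolled; row 0 is the boundary.\<close>

locale periodic_strip =
  fixes k :: nat and U :: "nat \<Rightarrow> nat \<Rightarrow> real"
  assumes periodic [simp]: "U (m + k) j = U m j"
begin

definition row_energy :: "nat \<Rightarrow> real" where
  "row_energy j = (\<Sum>m<k. (U (m + 1) j - U m j)\<^sup>2)"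

definition rise_energy :: "nat \<Rightarrow> real" where
  "rise_energy j = (\<Sum>m<k. (U m (Suc j) - U m j)\<^sup>2)"

definition height_energy :: "nat \<Rightarrow> real" where
  "height_energy j = (\<Sum>m<k. (U m j - U m 0)\<^sup>2)"

abbreviation "D \<equiv> shift_energy k (\<lambda>m. U m 0)"

lemma nonneg [simp]: "row_energy j \<ge> 0" "rise_energy j \<ge> 0" "height_energy j \<ge> 0"
  by (simp_all add: row_energy_def rise_energy_def height_energy_def sum_nonneg)

lemma height_energy_0 [simp]: "height_energy 0 = 0"
  by (simp add: height_energy_def)

text \<open>A jump is a sum of \<open>h\<close> unit steps. Cauchy-Schwarz gives one factor
  \<open>h\<close>; the other arises because each of the \<open>h\<close> steps, summed over the
  cycle, yields the whole row energy.\<close>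

lemma shift_energy_row: "shift_energy k (\<lambda>m. U m s) h \<le> (real h)\<^sup>2 * row_energy s"
proof -
  have "(U (m + h) s - U m s)\<^sup>2 \<le> h * (\<Sum>t<h. (U (m + t + 1) s - U (m + t) s)\<^sup>2)" for m
    using sum_squared_le_sum_of_squares[of "\<lambda>t. U (m + t + 1) s - U (m + t) s" "{..<h}"]
      sum_lessThan_telescope[of "\<lambda>t. U (m + t) s" h] by (simp add: mult.commute)
  then have "shift_energy k (\<lambda>m. U m s) h \<le> (\<Sum>m<k. h * (\<Sum>t<h. (U (m + t + 1) s - U (m + t) s)\<^sup>2))"
    unfolding shift_energy_def by (intro sum_mono)
  also have "\<dots> = h * (\<Sum>t<h. \<Sum>m<k. (U (m + t + 1) s - U (m + t) s)\<^sup>2)"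
    by (simp add: sum_distrib_left[symmetric] sum.swap[of _ "{..<h}"])
  also have "\<dots> = h * (\<Sum>t<h. row_energy s)"
    unfolding row_energy_def
  proof (rule arg_cong[where f = "(*) (real h)"], rule sum.cong[OF refl])
    fix t
    show "(\<Sum>m<k. (U (m + t + 1) s - U (m + t) s)\<^sup>2) = (\<Sum>m<k. (U (m + 1) s - U m s)\<^sup>2)"
      by (rule sum_periodic_shift[where g = "\<lambda>m. (U (m + 1) s - U m s)\<^sup>2"])
        (use periodic[of "Suc _"] in simp)
  qed
  also have "\<dots> = (real h)\<^sup>2 * row_energy s" by (simp add: power2_eq_square)
  finally show ?thesis .
qed

text \<open>Climb to row \<open>s\<close>, move along this row, and descend again.\<close>

lemma shift_energy_detour: "D h \<le> 3 * ((real h)\<^sup>2 * row_energy s + 2 * height_energy s)"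
proof -
  have "(U (m + h) 0 - U m 0)\<^sup>2 \<le>
      3 * ((U (m + h) s - U m s)\<^sup>2 + (U (m + h) s - U (m + h) 0)\<^sup>2 + (U m s - U m 0)\<^sup>2)" for m
    using power2_sum3_le[of "U (m + h) s - U m s" "U (m + h) 0 - U (m + h) s" "U m s - U m 0"]
    by (simp add: power2_commute)
  then have "D h \<le> (\<Sum>m<k. 3 * ((U (m + h) s - U m s)\<^sup>2 + (U (m + h) s - U (m + h) 0)\<^sup>2 + (U m s - U m 0)\<^sup>2))"
    unfolding shift_energy_def by (intro sum_mono)
  also have "\<dots> = 3 * (shift_energy k (\<lambda>m. U m s) h
      + (\<Sum>m<k. (U (m + h) s - U (m + h) 0)\<^sup>2) + height_energy s)"
    by (simp add: sum_distrib_left[symmetric] sum.distrib shift_energy_def height_energy_def)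
  \<comment> \<open>The shift by \<open>h\<close> only rotates the cycle, so the descents cost as
    much as the climbs.\<close>
  also have "(\<Sum>m<k. (U (m + h) s - U (m + h) 0)\<^sup>2) = height_energy s"
    unfolding height_energy_def
    by (rule sum_periodic_shift[where g = "\<lambda>m. (U m s - U m 0)\<^sup>2"]) simp
  finally show ?thesis using shift_energy_row[of s h] by simp
qed

text \<open>In each column the height difference is a telescoping sum of vertical increments, so
  Hardy's inequality applies columnwise. The term for \<open>s = 0\<close> is zero.\<close>

lemma height_energy_hardy:
  "(\<Sum>s<l. height_energy s / (real s)\<^sup>2) \<le> 4 * (\<Sum>j<l - 1. rise_energy j)"
proof (cases l)
  case (Suc n)
  have "(\<Sum>s<l. height_energy s / (real s)\<^sup>2) = (\<Sum>s=1..n. height_energy s / (real s)\<^sup>2)"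
    unfolding Suc by (intro sum.mono_neutral_right) (auto simp: less_Suc_eq_le)
  also have "\<dots> = (\<Sum>s=1..n. \<Sum>m<k. ((\<Sum>i<s. U m (Suc i) - U m i) / s)\<^sup>2)"
    by (simp add: height_energy_def sum_lessThan_telescope sum_divide_distrib power_divide)
  also have "\<dots> = (\<Sum>m<k. \<Sum>s=1..n. ((\<Sum>i<s. U m (Suc i) - U m i) / s)\<^sup>2)"
    by (rule sum.swap)
  also have "\<dots> \<le> (\<Sum>m<k. 4 * (\<Sum>i<n. (U m (Suc i) - U m i)\<^sup>2))"
    by (intro sum_mono hardy_inequality)
  also have "\<dots> = 4 * (\<Sum>j<n. rise_energy j)"
    unfolding rise_energy_def by (subst sum.swap) (simp add: sum_distrib_left)
  finally show ?thesis using Suc by simp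
qed simp

text \<open>For the shifts \<open>2s + 1\<close> and \<open>2s + 2\<close> the detour runs through row \<open>s\<close>.\<close>

lemma shift_energy_near:
  "(\<Sum>h=1..2 * l. D h / (real h)\<^sup>2) \<le>
    6 * (\<Sum>j<l. row_energy j) + 3 * (\<Sum>s<l. height_energy s / (real s)\<^sup>2)"
proof (induction l)
  case (Suc s)
  have D: "D h / (real h)\<^sup>2 \<le> 3 * row_energy s + 6 * (height_energy s / (real h)\<^sup>2)" if "h > 0" for h
    using shift_energy_detour[of h s] that by (simp add: field_simps)
  \<comment> \<open>The factor 1/4 turns the coefficients 6 of the two shifts into a total of
    3.\<close>
  have W: "height_energy s / (real h)\<^sup>2 \<le> height_energy s / (real s)\<^sup>2 / 4" if "h > 2 * s" for h
  proof (cases "s = 0")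
    case False
    have "(2 * real s)\<^sup>2 \<le> (real h)\<^sup>2" using that by (intro power_mono) auto
    then have "height_energy s / (real h)\<^sup>2 \<le> height_energy s / (2 * real s)\<^sup>2"
      using False that by (intro divide_left_mono) auto
    then show ?thesis by (simp add: power_mult_distrib)
  qed simp
  have "(\<Sum>h=1..2 * Suc s. D h / (real h)\<^sup>2) = (\<Sum>h=1..2 * s. D h / (real h)\<^sup>2)
      + D (2 * s + 1) / (real (2 * s + 1))\<^sup>2 + D (2 * s + 2) / (real (2 * s + 2))\<^sup>2"
    by simp
  also have "\<dots> \<le> (\<Sum>h=1..2 * s. D h / (real h)\<^sup>2)
      + 6 * row_energy s + 3 * (height_energy s / (real s)\<^sup>2)"
    using D[of "2 * s + 1"] D[of "2 * s + 2"] W[of "2 * s + 1"] W[of "2 * s + 2"] by linarith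
  finally show ?case using Suc.IH by simp
qed simp

text \<open>For long shifts the detour is averaged over all rows.\<close>

lemma shift_energy_far:
  assumes "l > 0" "2 * l \<le> n"
  shows "(\<Sum>h=2 * l + 1..n. D h / (real h)\<^sup>2) \<le>
    3 * (real n - 2 * l) / l * (\<Sum>j<l. row_energy j) + 3 * (\<Sum>s<l. height_energy s / (real s)\<^sup>2)"
proof -
  let ?H = "\<Sum>j<l. row_energy j" and ?X = "\<Sum>s<l. height_energy s / (real s)\<^sup>2"
  have X0: "?X \<ge> 0" by (intro sum_nonneg) simp
  \<comment> \<open>Heights in all rows below \<open>l\<close> are measured on the common scale
    \<open>l\<close>, to be compensated below by the decay of
    \<open>1 / (real h)\<^sup>2\<close>.\<close>
  have "height_energy s \<le> (real l)\<^sup>2 * (height_energy s / (real s)\<^sup>2)" if "s < l" for s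
  proof (cases "s = 0")
    case False
    have "(real s)\<^sup>2 \<le> (real l)\<^sup>2" using that by (intro power_mono) auto
    then have "(real s)\<^sup>2 * height_energy s \<le> (real l)\<^sup>2 * height_energy s"
      by (intro mult_right_mono) auto
    then show ?thesis using False by (simp add: field_simps)
  qed simp
  then have W: "(\<Sum>s<l. height_energy s) \<le> (real l)\<^sup>2 * ?X"
    unfolding sum_distrib_left by (intro sum_mono) simp
  have D: "D h / (real h)\<^sup>2 \<le> 3 / l * ?H + 6 * l * ?X * (1 / (real h)\<^sup>2)" if "h > 0" for h
  proof -
    \<comment> \<open>The detour bound is summed over all rows \<open>s < l\<close>; dividing by
      \<open>l\<close> then gives the average.\<close>
    have "l * D h = (\<Sum>s<l. D h)" by simp
    also have "\<dots> \<le> (\<Sum>s<l. 3 * ((real h)\<^sup>2 * row_energy s + 2 * height_energy s))"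
      by (intro sum_mono shift_energy_detour)
    also have "\<dots> = 3 * (real h)\<^sup>2 * ?H + 6 * (\<Sum>s<l. height_energy s)"
      by (simp add: distrib_left sum.distrib sum_distrib_left mult.assoc)
    also have "\<dots> \<le> 3 * (real h)\<^sup>2 * ?H + 6 * ((real l)\<^sup>2 * ?X)"
      using W by simp
    finally have "l * D h \<le> 3 * (real h)\<^sup>2 * ?H + 6 * ((real l)\<^sup>2 * ?X)" .
    then have "l * D h / (l * (real h)\<^sup>2) \<le> (3 * (real h)\<^sup>2 * ?H + 6 * ((real l)\<^sup>2 * ?X)) / (l * (real h)\<^sup>2)"
      by (rule divide_right_mono) simp
    also have "l * D h / (l * (real h)\<^sup>2) = D h / (real h)\<^sup>2" using assms by simp
    also have "(3 * (real h)\<^sup>2 * ?H + 6 * ((real l)\<^sup>2 * ?X)) / (l * (real h)\<^sup>2) = 3 / l * ?H + 6 * l * ?X * (1 / (real h)\<^sup>2)"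
      using assms that by (simp add: add_divide_distrib power2_eq_square)
    finally show ?thesis .
  qed
  \<comment> \<open>The tail beyond \<open>2 * l\<close> is at most \<open>1 / (2 * l)\<close>,
    which reduces the coefficient \<open>6 * l\<close> to 3.\<close>
  have "(\<Sum>h=2 * l + 1..n. 1 / (real h)\<^sup>2) \<le> 1 / (2 * l)"
    using sum_inverse_squares_le[of "2 * l" n] assms
    by (smt (verit) divide_nonneg_nonneg of_nat_0_le_iff mult_pos_pos zero_less_numeral)
  then have sq: "6 * l * ?X * (\<Sum>h=2 * l + 1..n. 1 / (real h)\<^sup>2) \<le> 6 * l * ?X * (1 / (2 * l))"
    using X0 by (intro mult_left_mono) auto
  have "(\<Sum>h=2 * l + 1..n. D h / (real h)\<^sup>2) \<le> (\<Sum>h=2 * l + 1..n. 3 / l * ?H + 6 * l * ?X * (1 / (real h)\<^sup>2))"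
    by (intro sum_mono D) auto
  also have "\<dots> = real (n - 2 * l) * (3 / l * ?H) + 6 * l * ?X * (\<Sum>h=2 * l + 1..n. 1 / (real h)\<^sup>2)"
    by (simp only: sum.distrib sum_distrib_left sum_constant) simp
  also have "\<dots> \<le> real (n - 2 * l) * (3 / l * ?H) + 6 * l * ?X * (1 / (2 * l))"
    using sq by simp
  also have "\<dots> = 3 * (real n - 2 * l) / l * ?H + 3 * ?X"
    using assms by (simp add: of_nat_diff)
  finally show ?thesis .
qed

text \<open>Near and far shifts together give the row energies the coefficient
  \<open>6 + 3 * (n - 2 * l) / l = 3 * n / l\<close>, at most \<open>3 * c\<close>. Each range
  contributes 3 to the weighted heights, and Hardy's factor 4 turns the total 6 into 24.\<close>

lemma trace_inequality:
  fixes c :: nat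
  assumes "l > 0" "2 * l \<le> n" "n \<le> c * l"
  shows "(\<Sum>h=1..n. D h / (real h)\<^sup>2) \<le>
    3 * real c * (\<Sum>j<l. row_energy j) + 24 * (\<Sum>j<l - 1. rise_energy j)"
proof -
  let ?H = "\<Sum>j<l. row_energy j" and ?X = "\<Sum>s<l. height_energy s / (real s)\<^sup>2"
  have "{1..n} = {1..2 * l} \<union> {2 * l + 1..n}" using assms by auto
  then have "(\<Sum>h=1..n. D h / (real h)\<^sup>2)
      = (\<Sum>h=1..2 * l. D h / (real h)\<^sup>2) + (\<Sum>h=2 * l + 1..n. D h / (real h)\<^sup>2)"
    by (simp add: sum.union_disjoint)
  also have "\<dots> \<le> (6 + 3 * (real n - 2 * l) / l) * ?H + 6 * ?X"
    using shift_energy_near[of l] shift_energy_far[OF assms(1,2)] by (simp add: algebra_simps)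
  also have "6 + 3 * (real n - 2 * l) / l = 3 * (real n / real l)"
    using assms by (simp add: field_simps)
  also have "3 * (real n / real l) * ?H \<le> 3 * real c * ?H"
  proof (intro mult_right_mono mult_left_mono sum_nonneg)
    have "real n \<le> real c * real l" using assms(3) by (metis of_nat_le_iff of_nat_mult)
    then show "real n / real l \<le> real c" using assms(1) by (simp add: field_simps)
  qed auto
  finally show ?thesis using height_energy_hardy[of l] by linarith
qed

end

section \<open>Extension by window means\<close>

text \<open>After exchanging the sums, \<open>D h\<close> has as weight the sum of
  \<open>1 / (x * (x + 1)\<^sup>2)\<close> over \<open>x = h, ..., N\<close>. A telescoping
  comparison bounds it by \<open>1 / (2 * h\<^sup>2) - 1 / (2 * (N + 1)\<^sup>2)\<close>; keeping
  the subtracted term makes the induction close.\<close>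

lemma averaged_shift_energy:
  fixes D :: "nat \<Rightarrow> real"
  assumes nonneg: "\<And>h. D h \<ge> 0"
  shows "(\<Sum>j<N. (\<Sum>h=1..j + 1. D h) / ((real j + 1) * (real j + 2)\<^sup>2)) \<le>
    1 / 2 * (\<Sum>h=1..N. D h / (real h)\<^sup>2) - (\<Sum>h=1..N. D h) / (2 * (real N + 1)\<^sup>2)"
proof (induction N)
  case (Suc N)
  define T where "T = (\<Sum>h=1..Suc N. D h)"
  have T0: "T \<ge> 0" unfolding T_def by (intro sum_nonneg nonneg)
  define x where "x = real N + 1"
  have x: "x > 0" by (simp add: x_def)
  define q where "q = T / (2 * x\<^sup>2)"
  define r where "r = T / (2 * (x + 1)\<^sup>2)"
  define d where "d = D (Suc N) / x\<^sup>2"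
  \<comment> \<open>Over the common denominator \<open>2 * x\<^sup>2 * (x + 1)\<^sup>2\<close> the
    numerators are \<open>2 * x\<close> and \<open>2 * x + 1\<close>.\<close>
  have "1 / (x * (x + 1)\<^sup>2) \<le> 1 / (2 * x\<^sup>2) - 1 / (2 * (x + 1)\<^sup>2)"
    using x by (simp add: divide_simps) (simp add: algebra_simps power2_eq_square)
  then have "T * (1 / (x * (x + 1)\<^sup>2)) \<le> T * (1 / (2 * x\<^sup>2) - 1 / (2 * (x + 1)\<^sup>2))"
    using T0 by (rule mult_left_mono)
  then have step: "T / (x * (x + 1)\<^sup>2) \<le> q - r"
    by (simp add: q_def r_def right_diff_distrib)
  define P where "P n = (\<Sum>j<n. (\<Sum>h=1..j + 1. D h) / ((real j + 1) * (real j + 2)\<^sup>2))" for n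
  define S where "S n = (\<Sum>h=1..n. D h / (real h)\<^sup>2)" for n
  have "(\<Sum>h=1..N. D h) = T - D (Suc N)" by (simp add: T_def)
  then have "(\<Sum>h=1..N. D h) / (2 * x\<^sup>2) = q - d / 2"
    by (simp add: q_def d_def diff_divide_distrib)
  then have "P N \<le> 1 / 2 * S N - (q - d / 2)"
    using Suc.IH by (simp only: P_def S_def x_def)
  moreover have "S (Suc N) = S N + d"
    by (simp add: S_def d_def x_def add.commute)
  moreover have "P (Suc N) = P N + T / (x * (x + 1)\<^sup>2)"
    by (simp add: P_def T_def x_def add.assoc)
  ultimately have "P (Suc N) \<le> 1 / 2 * S (Suc N) - r" using step by linarith
  then show ?case unfolding P_def S_def by (simp add: r_def T_def x_def)
qed simp

definition window_mean :: "(nat \<Rightarrow> real) \<Rightarrow> nat \<Rightarrow> nat \<Rightarrow> real" where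
  "window_mean f m j = (\<Sum>t<Suc j. f (m + t)) / Suc j"

lemma window_mean_0 [simp]: "window_mean f m 0 = f m"
  by (simp add: window_mean_def)

text \<open>Moving the window by one column drops its first entry and adds one at the end, so the
  sums differ by a single jump of length \<open>Suc j\<close>.\<close>

lemma window_mean_row:
  "(\<Sum>m<k. (window_mean f (m + 1) j - window_mean f m j)\<^sup>2) = shift_energy k f (Suc j) / (real (Suc j))\<^sup>2"
proof -
  have "window_mean f (m + 1) j - window_mean f m j = (f (m + Suc j) - f m) / Suc j" for m
  proof -
    have "(\<Sum>t<Suc j. f (m + 1 + t)) - (\<Sum>t<Suc j. f (m + t)) = f (m + Suc j) - f m"
      using sum_lessThan_telescope[of "\<lambda>t. f (m + t)" "Suc j"]
      by (simp add: sum_subtractf del: sum.lessThan_Suc)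
    then show ?thesis by (simp add: window_mean_def flip: diff_divide_distrib del: sum.lessThan_Suc)
  qed
  then show ?thesis
    by (simp add: shift_energy_def power_divide sum_divide_distrib)
qed

text \<open>Enlarging the window changes the mean by the sum of all differences between the new
  entry and the old ones, divided by \<open>(j + 1) * (j + 2)\<close>. Cauchy-Schwarz costs one
  factor \<open>j + 1\<close>, and the differences are jumps of lengths 1 to
  \<open>j + 1\<close>.\<close>

lemma window_mean_rise:
  assumes periodic: "\<And>m. f (m + k) = f m"
  shows "(\<Sum>m<k. (window_mean f m (Suc j) - window_mean f m j)\<^sup>2) \<le>
    (\<Sum>h=1..j + 1. shift_energy k f h) / ((real j + 1) * (real j + 2)\<^sup>2)"
proof -
  let ?n = "Suc j"
  have diff: "(window_mean f m (Suc j) - window_mean f m j)\<^sup>2 \<le>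
      (\<Sum>t<?n. (f (m + ?n) - f (m + t))\<^sup>2) / ((real j + 1) * (real j + 2)\<^sup>2)" for m
  proof -
    define S where "S = (\<Sum>t<?n. f (m + t))"
    have "window_mean f m (Suc j) - window_mean f m j = (S + f (m + ?n)) / (real j + 2) - S / (real j + 1)"
      by (simp add: window_mean_def S_def add_ac)
    also have "\<dots> = (?n * f (m + ?n) - S) / ((real j + 1) * (real j + 2))"
      by (simp add: divide_simps) (simp add: algebra_simps)
    also have "?n * f (m + ?n) - S = (\<Sum>t<?n. f (m + ?n) - f (m + t))"
      by (simp add: S_def sum_subtractf del: sum.lessThan_Suc)
    finally have "(window_mean f m (Suc j) - window_mean f m j)\<^sup>2 =
        (\<Sum>t<?n. f (m + ?n) - f (m + t))\<^sup>2 / ((real j + 1) * (real j + 2))\<^sup>2"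
      by (simp only: power_divide)
    also have "\<dots> \<le> (?n * (\<Sum>t<?n. (f (m + ?n) - f (m + t))\<^sup>2)) / ((real j + 1) * (real j + 2))\<^sup>2"
      using sum_squared_le_sum_of_squares[of "\<lambda>t. f (m + ?n) - f (m + t)" "{..<?n}"]
      by (intro divide_right_mono) (simp_all del: sum.lessThan_Suc add: mult.commute)
    also have "\<dots> = (real j + 1) * (\<Sum>t<?n. (f (m + ?n) - f (m + t))\<^sup>2) / ((real j + 1) * ((real j + 1) * (real j + 2)\<^sup>2))"
      by (simp add: power2_eq_square mult_ac add.commute del: sum.lessThan_Suc)
    also have "\<dots> = (\<Sum>t<?n. (f (m + ?n) - f (m + t))\<^sup>2) / ((real j + 1) * (real j + 2)\<^sup>2)"
      by (rule mult_divide_mult_cancel_left) simp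
    finally show ?thesis .
  qed
  have "(\<Sum>m<k. \<Sum>t<?n. (f (m + ?n) - f (m + t))\<^sup>2) = (\<Sum>t<?n. \<Sum>m<k. (f (m + ?n) - f (m + t))\<^sup>2)"
    by (rule sum.swap)
  \<comment> \<open>By periodicity the base point \<open>m + t\<close> may be taken as the new
    summation index.\<close>
  also have "\<dots> = (\<Sum>t<?n. shift_energy k f (?n - t))"
  proof (rule sum.cong[OF refl])
    fix t assume "t \<in> {..<?n}"
    then have t: "m + ?n = m + t + (?n - t)" for m by simp
    have "(f (m + k + (?n - t)) - f (m + k))\<^sup>2 = (f (m + (?n - t)) - f m)\<^sup>2" for m
      using periodic[of m] periodic[of "m + (?n - t)"] by (simp add: add_ac)
    from sum_periodic_shift[where g = "\<lambda>m. (f (m + (?n - t)) - f m)\<^sup>2", OF this, of t]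
    show "(\<Sum>m<k. (f (m + ?n) - f (m + t))\<^sup>2) = shift_energy k f (?n - t)"
      unfolding shift_energy_def t .
  qed
  also have "\<dots> = (\<Sum>h=1..j + 1. shift_energy k f h)"
    by (rule sum.reindex_bij_witness[where i = "\<lambda>h. ?n - h" and j = "\<lambda>t. ?n - t"]) auto
  finally have "(\<Sum>m<k. (\<Sum>t<?n. (f (m + ?n) - f (m + t))\<^sup>2) / ((real j + 1) * (real j + 2)\<^sup>2)) =
      (\<Sum>h=1..j + 1. shift_energy k f h) / ((real j + 1) * (real j + 2)\<^sup>2)"
    by (simp only: sum_divide_distrib[symmetric])
  moreover have "(\<Sum>m<k. (window_mean f m (Suc j) - window_mean f m j)\<^sup>2) \<le>
      (\<Sum>m<k. (\<Sum>t<?n. (f (m + ?n) - f (m + t))\<^sup>2) / ((real j + 1) * (real j + 2)\<^sup>2))"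
    by (intro sum_mono diff)
  ultimately show ?thesis by simp
qed

lemma window_mean_energy:
  assumes periodic: "\<And>m. f (m + k) = f m"
  shows "(\<Sum>j<l. \<Sum>m<k. (window_mean f (m + 1) j - window_mean f m j)\<^sup>2) +
      (\<Sum>j<l - 1. \<Sum>m<k. (window_mean f m (Suc j) - window_mean f m j)\<^sup>2) \<le>
    3 / 2 * (\<Sum>h=1..l. shift_energy k f h / (real h)\<^sup>2)"
proof -
  let ?D = "shift_energy k f"
  have row: "(\<Sum>j<l. \<Sum>m<k. (window_mean f (m + 1) j - window_mean f m j)\<^sup>2) = (\<Sum>h=1..l. ?D h / (real h)\<^sup>2)"
    unfolding window_mean_row
    by (rule sum.reindex_bij_witness[where i = "\<lambda>h. h - 1" and j = Suc]) auto
  have "(\<Sum>j<l - 1. \<Sum>m<k. (window_mean f m (Suc j) - window_mean f m j)\<^sup>2) \<le>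
      (\<Sum>j<l - 1. (\<Sum>h=1..j + 1. ?D h) / ((real j + 1) * (real j + 2)\<^sup>2))"
    by (intro sum_mono window_mean_rise periodic)
  also have "\<dots> \<le> 1 / 2 * (\<Sum>h=1..l - 1. ?D h / (real h)\<^sup>2) - (\<Sum>h=1..l - 1. ?D h) / (2 * (real (l - 1) + 1)\<^sup>2)"
    by (rule averaged_shift_energy) simp
  also have "\<dots> \<le> 1 / 2 * (\<Sum>h=1..l - 1. ?D h / (real h)\<^sup>2)"
    by (simp add: sum_nonneg)
  also have "\<dots> \<le> 1 / 2 * (\<Sum>h=1..l. ?D h / (real h)\<^sup>2)"
    by (intro mult_left_mono sum_mono2) auto
  finally show ?thesis unfolding row by simp
qed

section \<open>The energy minimizer\<close>

text \<open>Tychonoff's theorem, transferred to the topology of the function type.\<close>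

lemma compact_PiE_UNIV:
  fixes C :: "'a \<Rightarrow> real set"
  assumes "\<And>i. compact (C i)"
  shows "compact (PiE UNIV C)"
proof -
  have "compactin (product_topology (\<lambda>i. euclidean) UNIV) (PiE UNIV C)"
    using assms by (simp add: compactin_PiE)
  then show ?thesis by (simp add: euclidean_product_topology)
qed

lemma power2_clamp_diff_le:
  fixes x y a b :: real
  shows "(max a (min b x) - max a (min b y))\<^sup>2 \<le> (x - y)\<^sup>2"
  by (intro abs_le_square_iff[THEN iffD1]) (auto simp: max_def min_def)

text \<open>Truncating to the range of the boundary values does not increase the energy, so it suffices
  to minimize over a compact set of functions.\<close>

lemma energy_minimizer_exists:
  assumes "k \<ge> 3"
  shows "\<exists>u. is_arg_min (energy_seminorm (grid k l)) (extends_boundary k \<phi>) u"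
proof -
  define a where "a = Min (\<phi> ` {1..k})"
  define b where "b = Max (\<phi> ` {1..k})"
  have ab: "a \<le> \<phi> i" "\<phi> i \<le> b" if "i \<in> {1..k}" for i
    using that by (auto simp: a_def b_def)
  have "1 \<in> {1..k}" using assms by simp
  then have ab': "a \<le> b" using ab order_trans by blast
  \<comment> \<open>Boundary coordinates are pinned. All other pairs, including those outside the
    grid, range over \<open>{a..b}\<close>, so that every factor of the infinite product is
    compact.\<close>
  define C where "C p = (if snd p = 1 \<and> fst p \<in> {1..k} then {\<phi> (fst p)} else {a..b})" for p :: "nat \<times> nat"
  have C: "compact (PiE UNIV C)"
    by (rule compact_PiE_UNIV) (simp add: C_def)
  have "PiE UNIV C \<noteq> {}"
    using ab' by (auto simp: PiE_eq_empty_iff C_def split: if_splits)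
  have cont: "continuous_on (PiE UNIV C) (grid_energy k l)"
    unfolding grid_energy_def
    by (intro continuous_intros continuous_on_subset[OF continuous_on_product_coordinates]) auto
  obtain u where u: "u \<in> PiE UNIV C" "\<And>v. v \<in> PiE UNIV C \<Longrightarrow> grid_energy k l u \<le> grid_energy k l v"
    using continuous_attains_inf[OF C \<open>PiE UNIV C \<noteq> {}\<close> cont] by blast
  have "grid_energy k l u \<le> grid_energy k l v" if v: "extends_boundary k \<phi> v" for v
  proof -
    define w where "w p = max a (min b (v p))" for p
    \<comment> \<open>Clamping to \<open>{a..b}\<close> leaves the boundary values unchanged, since
      they lie in this interval.\<close>
    have "w p \<in> C p" for p
    proof (cases "snd p = 1 \<and> fst p \<in> {1..k}")
      case True
      then have "v p = \<phi> (fst p)" using v by (cases p) (auto simp: extends_boundary_def)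
      then show ?thesis using True ab[of "fst p"] by (simp add: w_def C_def)
    next
      case False
      then have "C p = {a..b}" by (simp only: C_def if_False)
      then show ?thesis using ab' by (simp add: w_def)
    qed
    then have "grid_energy k l u \<le> grid_energy k l w"
      by (intro u(2)) (simp add: PiE_iff)
    also have "\<dots> \<le> grid_energy k l v"
      unfolding grid_energy_def w_def by (intro add_mono sum_mono power2_clamp_diff_le)
    finally show ?thesis .
  qed
  moreover have "extends_boundary k \<phi> u"
  proof -
    have "u (i, 1) \<in> C (i, 1)" for i using u(1) by (auto simp: PiE_iff)
    then show ?thesis by (fastforce simp: extends_boundary_def C_def split: if_splits)
  qed
  ultimately show ?thesis
    using assms by (auto simp: is_arg_min_linorder energy_seminorm_grid)
qed

section \<open>The two estimates and the theorem\<close>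

lemma boundary_seminorm_le_energy:
  fixes k l c :: nat
  assumes "l > 0" "4 * l < k" "k < 2 * c * l" "extends_boundary k \<phi> u"
  shows "(boundary_seminorm k l \<phi>)\<^sup>2 \<le> (max (sqrt (3 * real c)) (2 * pi))\<^sup>2 * grid_energy k l u"
proof -
  let ?M = "max (sqrt (3 * real c)) (2 * pi)"
  define U where "U m j = u (cycle_vertex k m, Suc j)" for m j
  interpret periodic_strip k U
    by unfold_locales (simp add: U_def)
  have k: "k > 0" using assms by simp
  have U0: "U m 0 = \<phi> (cycle_vertex k m)" for m
    using assms(4) cycle_vertex_in[OF k] by (simp add: U_def extends_boundary_def)
  have E: "grid_energy k l u = (\<Sum>j<l. row_energy j) + (\<Sum>j<l - 1. rise_energy j)"
    by (simp add: grid_energy_def row_energy_def rise_energy_def U_def)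
  have "(boundary_seminorm k l \<phi>)\<^sup>2 \<le> (\<Sum>h=1..k div 2. D h / (real h)\<^sup>2)"
    using boundary_seminorm_le[OF k assms(1)] by (simp add: U0)
  also have "\<dots> \<le> 3 * real c * (\<Sum>j<l. row_energy j) + 24 * (\<Sum>j<l - 1. rise_energy j)"
    \<comment> \<open>With \<open>n = k div 2\<close>, the hypotheses \<open>4 * l < k\<close> and
      \<open>k < 2 * c * l\<close> give \<open>2 * l \<le> n\<close> and
      \<open>n \<le> c * l\<close>.\<close>
    using assms by (intro trace_inequality) auto
  also have "\<dots> \<le> ?M\<^sup>2 * (\<Sum>j<l. row_energy j) + ?M\<^sup>2 * (\<Sum>j<l - 1. rise_energy j)"
  proof (intro add_mono mult_right_mono sum_nonneg)
    have "(sqrt (3 * real c))\<^sup>2 \<le> ?M\<^sup>2" by (intro power_mono) auto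
    then show "3 * real c \<le> ?M\<^sup>2" by simp
    \<comment> \<open>From \<open>sin (pi / 6) = 1 / 2\<close> one gets \<open>pi \<ge> 3\<close>,
      hence the square of \<open>2 * pi\<close> is at least 36.\<close>
    have "1 / 2 \<le> pi / 6" using sin_x_le_x[of "pi / 6"] by (simp add: sin_30)
    then have "6 \<le> ?M" by simp
    then have "6\<^sup>2 \<le> ?M\<^sup>2" by (intro power_mono) auto
    then show "24 \<le> ?M\<^sup>2" by simp
  qed auto
  finally show ?thesis by (simp add: E distrib_left)
qed

text \<open>The window means involve only shifts up to \<open>l\<close>. As
  \<open>2 * l < k\<close>, these are shorter than half the cycle, so their sum is bounded by the
  squared boundary semi-norm.\<close>

lemma energy_extension:
  assumes "l > 0" "2 * l < k"
  shows "\<exists>u. extends_boundary k \<phi> u \<and> grid_energy k l u \<le> 3 / 2 * (boundary_seminorm k l \<phi>)\<^sup>2"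
proof -
  have k: "k > 0" using assms by simp
  define f where "f m = \<phi> (cycle_vertex k m)" for m
  have f: "f (m + k) = f m" for m by (simp add: f_def)
  define u where "u p = window_mean f (fst p - 1) (snd p - 1)" for p
  \<comment> \<open>Windows may wrap around the cycle; periodicity makes their means independent of
    the representative of the column.\<close>
  have "f (m mod k + t) = f (m + t)" for m t
    by (simp add: f_def cycle_vertex_def mod_add_left_eq)
  then have u: "u (cycle_vertex k m, Suc j) = window_mean f m j" for m j
    by (simp add: u_def cycle_vertex_def window_mean_def del: sum.lessThan_Suc)
  have "extends_boundary k \<phi> u"
    by (auto simp: extends_boundary_def u_def f_def cycle_vertex_def)
  moreover have "grid_energy k l u \<le> 3 / 2 * (\<Sum>h=1..l. shift_energy k f h / (real h)\<^sup>2)"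
    unfolding grid_energy_def u by (rule window_mean_energy) (rule f)
  moreover have "(\<Sum>h=1..l. shift_energy k f h / (real h)\<^sup>2) \<le> (boundary_seminorm k l \<phi>)\<^sup>2"
    unfolding f_def by (rule boundary_seminorm_ge[OF k assms])
  ultimately show ?thesis by (intro exI[of _ u]) simp
qed

text \<open>The minimum is expressed through a minimizer \<open>u\<close>, so its attainment is part
  of the claim. The lower bound holds for every extension; the upper one compares \<open>u\<close>
  with the window means.\<close>

theorem theorem3p3:
  fixes k l c :: nat and \<phi> :: "nat \<Rightarrow> real"
  assumes "k > 0" and "l > 0" and "c > 0"
    and "4 * l < k" and "k < 2 * c * l"
  shows "\<exists>u. is_arg_min (energy_seminorm (grid k l)) (extends_boundary k \<phi>) u \<and>
    1 / max (sqrt (3 * real c)) (2 * pi) * boundary_seminorm k l \<phi> \<le> energy_seminorm (grid k l) u \<and>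
    energy_seminorm (grid k l) u \<le> sqrt (2 * real c + 233 / 9) * boundary_seminorm k l \<phi>"
proof -
  let ?M = "max (sqrt (3 * real c)) (2 * pi)" and ?B = "boundary_seminorm k l \<phi>"
  have k3: "k \<ge> 3" using assms by simp
  have M: "?M > 0" by (simp add: less_max_iff_disj)
  have B: "?B \<ge> 0" by (auto simp: boundary_seminorm_def intro!: sum_nonneg)
  obtain u where u: "is_arg_min (energy_seminorm (grid k l)) (extends_boundary k \<phi>) u"
    using energy_minimizer_exists[OF k3] by blast
  obtain v where v: "extends_boundary k \<phi> v" "grid_energy k l v \<le> 3 / 2 * ?B\<^sup>2"
    using energy_extension[of l k \<phi>] assms by auto
  have ext: "extends_boundary k \<phi> u" using u by (simp add: is_arg_min_def)
  have "?B = sqrt (?B\<^sup>2)" using B by simp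
  also have "\<dots> \<le> sqrt (?M\<^sup>2 * grid_energy k l u)"
    using boundary_seminorm_le_energy[OF assms(2,4,5) ext] by (rule real_sqrt_le_mono)
  also have "\<dots> = ?M * energy_seminorm (grid k l) u"
    using M by (simp add: real_sqrt_mult energy_seminorm_grid[OF k3])
  finally have lower: "1 / ?M * ?B \<le> energy_seminorm (grid k l) u"
    using M by (simp add: pos_divide_le_eq mult.commute)
  have "energy_seminorm (grid k l) u \<le> energy_seminorm (grid k l) v"
    using u v(1) by (simp add: is_arg_min_linorder)
  also have "\<dots> \<le> sqrt (3 / 2 * ?B\<^sup>2)"
    using v(2) by (simp add: energy_seminorm_grid[OF k3])
  \<comment> \<open>Already \<open>3 / 2 \<le> 233 / 9\<close>.\<close>
  also have "\<dots> \<le> sqrt ((2 * real c + 233 / 9) * ?B\<^sup>2)"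
    by (intro real_sqrt_le_mono mult_right_mono) auto
  also have "\<dots> = sqrt (2 * real c + 233 / 9) * ?B"
    using B by (simp add: real_sqrt_mult)
  finally have upper: "energy_seminorm (grid k l) u \<le> sqrt (2 * real c + 233 / 9) * ?B" .
  show ?thesis using u lower upper by blast
qed

end
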